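(* Let $\eta>0$, $t\in(0,d]$, let $v\in\mathcal A^{\eta,t}_G$, let $0<\varepsilon\le\|v\|_{\mathcal A^{\eta,t}_G}$, and let $w\in V$ be such that $$\|v-w\|\le\varepsilon.$$ Let $N=N(\varepsilon)$ be the smallest integer such that the best $N$-term approximation $w_N$ of $w$ satisfies $\|w-w_N\|\le2\varepsilon$. Then $\|v-w_N\|\le3\varepsilon$ and $$N\le\frac{\omega_d}{\eta^{d/t}}\left(\log\frac{\|v\|_{\mathcal A^{\eta,t}_G}}{\varepsilon}\right)^{d/t}+1 .$$
   Context: Let $d\ge1$, $\Omega=(0,2\pi)^d$, $\phi_k(x)=(2\pi)^{-d/2}e^{ik\cdot x}$ for $k\in\mathbb Z^d$, $\hat v_k=(v,\phi_k)_{L^2(\Omega)}$. $V=H^1_p(\Omega)$: $H^1$ functions $2\pi$-periodic in each direction, norm $\|v\|^2=\sum_k(1+|k|^2)|\hat v_k|^2$ ($|k|$ Euclidean). For $\Lambda\subset\mathbb Z^d$, $P_\Lambda v=\sum_{k\in\Lambda}\hat v_k\phi_k$. A best $N$-term approximation of $w$ is $w_N=P_{\Lambda_N}w$ where $\Lambda_N$ minimizes $\|w-P_\Lambda w\|$ over sets of cardinality $N$ ($w_0=0$). $E_N(v)=\inf_{|\Lambda|=N}\|v-P_\Lambda v\|$ ($E_0(v)=\|v\|$). $\omega_d$ is the measure of the Euclidean unit ball in $\mathbb R^d$. Exponential class: $\mathcal A^{\eta,t}_G=\{v\in V:\ \|v\|_{\mathcal A^{\eta,t}_G}:=\sup_{N\ge0}E_N(v)\exp(\eta\,\omega_d^{-t/d}N^{t/d})<\infty\}$.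 *)

theory Defs
  imports "HOL-Analysis.Analysis"
begin

text \<open>
  The dimension is \<open>d = CARD('n)\<close>; multi-indices in the integer lattice have type \<open>int ^ 'n\<close>.
  Elements of the function spaces are represented by functions on the whole space (not by
  equivalence classes modulo null sets), and they are complex valued, as the Fourier modes are.
\<close>

definition Omega :: "(real ^ 'n) set" where
  "Omega = box 0 (\<chi> i. 2 * pi)"

definition fourier_mode :: "int ^ 'n \<Rightarrow> real ^ 'n \<Rightarrow> complex" where
  "fourier_mode k x = complex_of_real ((2 * pi) powr (- real CARD('n) / 2)) *
     exp (\<i> * complex_of_real (\<Sum>i\<in>UNIV. real_of_int (k $ i) * x $ i))"

definition fourier_coeff :: "(real ^ 'n \<Rightarrow> complex) \<Rightarrow> int ^ 'n \<Rightarrow> complex" where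
  "fourier_coeff v k = (LINT x:Omega|lebesgue. v x * cnj (fourier_mode k x))"

definition periodic :: "(real ^ 'n \<Rightarrow> complex) \<Rightarrow> bool" where
  "periodic v \<longleftrightarrow> (\<forall>x j. v (x + axis j (2 * pi)) = v x)"

definition square_integrable_Omega :: "(real ^ 'n \<Rightarrow> complex) \<Rightarrow> bool" where
  "square_integrable_Omega v \<longleftrightarrow>
     set_borel_measurable lebesgue Omega v \<and>
     set_integrable lebesgue Omega (\<lambda>x. (cmod (v x))\<^sup>2)"

definition partial_deriv :: "'n \<Rightarrow> (real ^ 'n \<Rightarrow> complex) \<Rightarrow> real ^ 'n \<Rightarrow> complex" where
  "partial_deriv j f x = frechet_derivative f (at x) (axis j 1)"

primrec C_diff :: "nat \<Rightarrow> (real ^ 'n \<Rightarrow> complex) \<Rightarrow> bool" where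
  "C_diff 0 f \<longleftrightarrow> continuous_on UNIV f"
| "C_diff (Suc m) f \<longleftrightarrow> (\<forall>x. f differentiable (at x)) \<and> (\<forall>j. C_diff m (partial_deriv j f))"

definition smooth :: "(real ^ 'n \<Rightarrow> complex) \<Rightarrow> bool" where
  "smooth f \<longleftrightarrow> (\<forall>m. C_diff m f)"

text \<open>
  The weak derivative is the one on the torus: the test functions are the smooth periodic
  functions.  With test functions compactly supported in \<open>Omega\<close> only, the condition would not
  see jumps of \<open>v\<close> across opposite faces of the cube, that is, it would not force the traces
  on opposite faces to match.
\<close>

definition has_weak_partial_deriv ::
    "'n \<Rightarrow> (real ^ 'n \<Rightarrow> complex) \<Rightarrow> (real ^ 'n \<Rightarrow> complex) \<Rightarrow> bool" where
  "has_weak_partial_deriv j v g \<longleftrightarrow>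
     (\<forall>\<psi>. smooth \<psi> \<and> periodic \<psi> \<longrightarrow>
        (LINT x:Omega|lebesgue. v x * partial_deriv j \<psi> x) = - (LINT x:Omega|lebesgue. g x * \<psi> x))"

definition H1p :: "(real ^ 'n \<Rightarrow> complex) set" where
  "H1p = {v. periodic v \<and> square_integrable_Omega v \<and>
     (\<forall>j. \<exists>g. square_integrable_Omega g \<and> has_weak_partial_deriv j v g)}"

text \<open>Meaningful on \<open>H1p\<close>, where the series converges (\<open>infsum\<close> is 0 for divergent series).\<close>

definition H1_norm :: "(real ^ 'n \<Rightarrow> complex) \<Rightarrow> real" where
  "H1_norm v = sqrt (\<Sum>\<^sub>\<infinity>k\<in>UNIV.
     (1 + (\<Sum>i\<in>UNIV. (real_of_int (k $ i))\<^sup>2)) * (cmod (fourier_coeff v k))\<^sup>2)"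

text \<open>Only used for finite index sets.\<close>

definition fourier_proj :: "(int ^ 'n) set \<Rightarrow> (real ^ 'n \<Rightarrow> complex) \<Rightarrow> real ^ 'n \<Rightarrow> complex" where
  "fourier_proj \<Lambda> v = (\<lambda>x. \<Sum>k\<in>\<Lambda>. fourier_coeff v k * fourier_mode k x)"

text \<open>A predicate, since ties between Fourier coefficients make the minimizing set non-unique.\<close>

definition best_approx :: "(real ^ 'n \<Rightarrow> complex) \<Rightarrow> nat \<Rightarrow> (real ^ 'n \<Rightarrow> complex) \<Rightarrow> bool" where
  "best_approx w N u \<longleftrightarrow>
     (\<exists>\<Lambda>. is_arg_min (\<lambda>\<Lambda>. H1_norm (w - fourier_proj \<Lambda> w)) (\<lambda>\<Lambda>. finite \<Lambda> \<and> card \<Lambda> = N) \<Lambda> \<and>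
          u = fourier_proj \<Lambda> w)"

definition best_error :: "nat \<Rightarrow> (real ^ 'n \<Rightarrow> complex) \<Rightarrow> real" where
  "best_error N v = (INF \<Lambda>\<in>{\<Lambda>. finite \<Lambda> \<and> card \<Lambda> = N}. H1_norm (v - fourier_proj \<Lambda> v))"

definition unit_ball_measure :: "'n::finite itself \<Rightarrow> real" where
  "unit_ball_measure _ = measure lebesgue (ball (0 :: real ^ 'n) 1)"

text \<open>For \<open>N = 0\<close> the factor \<open>real N powr (t / d)\<close> is 0, as intended.\<close>

definition weighted_error :: "real \<Rightarrow> real \<Rightarrow> (real ^ 'n \<Rightarrow> complex) \<Rightarrow> nat \<Rightarrow> real" where
  "weighted_error \<eta> t v N = best_error N v *
     exp (\<eta> * unit_ball_measure TYPE('n) powr (- t / real CARD('n)) *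
          real N powr (t / real CARD('n)))"

definition exp_class :: "real \<Rightarrow> real \<Rightarrow> (real ^ 'n \<Rightarrow> complex) set" where
  "exp_class \<eta> t = {v \<in> H1p. bdd_above (range (weighted_error \<eta> t v))}"

definition exp_class_norm :: "real \<Rightarrow> real \<Rightarrow> (real ^ 'n \<Rightarrow> complex) \<Rightarrow> real" where
  "exp_class_norm \<eta> t v = (SUP N. weighted_error \<eta> t v N)"

definition is_smallest_N :: "(real ^ 'n \<Rightarrow> complex) \<Rightarrow> real \<Rightarrow> nat \<Rightarrow> bool" where
  "is_smallest_N w \<delta> N \<longleftrightarrow>
     is_arg_min (\<lambda>n. n) (\<lambda>n. \<exists>u. best_approx w n u \<and> H1_norm (w - u) \<le> \<delta>) N"

end

theory Submission imports Defs
begin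

text \<open>
  The proof takes place on the side of the Fourier coefficients, where the norm of \<open>V\<close> is a
  weighted \<open>l\<^sup>2\<close> norm and projecting onto \<open>\<Lambda>\<close> means deleting the coefficients outside \<open>\<Lambda>\<close>.

  Let \<open>N\<close> be the smallest number of terms that suffices for the error \<open>2 * \<epsilon>\<close>.  The bound
  \<open>H1_norm (v - w\<^sub>N) \<le> 3 * \<epsilon>\<close> is the triangle inequality through \<open>w\<close>.  For the bound on \<open>N\<close>,
  suppose \<open>N > 0\<close>.  By minimality the best approximation of \<open>w\<close> with \<open>N - 1\<close> terms has an error
  above \<open>2 * \<epsilon>\<close>, hence so has every projection of \<open>w\<close> onto \<open>N - 1\<close> modes.  Since
  \<open>v - w\<close> has norm at most \<open>\<epsilon>\<close> and deleting coefficients does not increase the norm, every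
  projection of \<open>v\<close> onto \<open>N - 1\<close> modes has an error of at least \<open>\<epsilon>\<close>
  (lemma \<open>le_best_error_below_smallest_N\<close>).  The exponential decay of the best errors of \<open>v\<close>
  allows this only if \<open>N - 1\<close> is at most the stated logarithmic expression
  (lemma \<open>index_le_of_le_best_error\<close>).

  Two facts support this argument.  The series defining the norm has to converge on \<open>H1p\<close>: the
  coefficients of a weak partial derivative are \<open>\<i> * k $ j\<close> times those of the function, so
  Bessel's inequality for the function and for its weak derivatives bounds the weighted sum
  (lemmas \<open>bessel_inequality\<close> and \<open>H1p_summable\<close>).  Best approximations have to exist, with every
  number of terms: a summable nonnegative family has \<open>N\<close> largest terms, and keeping those is
  optimal (lemmas \<open>ex_dominating_subset\<close> and \<open>ex_best_approx\<close>).  That some number of terms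
  suffices follows since the remainders of the convergent series become arbitrarily small.
\<close>

section \<open>Weighted square summable families\<close>

text \<open>
  Minkowski's inequality.  It is the inequality for finite sums, with the factors
  \<open>sqrt (q k)\<close> absorbed into the terms: the partial sums over finite sets are bounded by the
  square of the right-hand side, and this bound gives summability as well as the estimate.
\<close>

lemma weighted_l2_triangle:
  fixes c d :: "'a \<Rightarrow> complex"
  assumes q: "\<And>k. 0 \<le> q k"
    and c: "(\<lambda>k. q k * (cmod (c k))\<^sup>2) summable_on UNIV"
    and d: "(\<lambda>k. q k * (cmod (d k))\<^sup>2) summable_on UNIV"
  shows "(\<lambda>k. q k * (cmod (c k + d k))\<^sup>2) summable_on UNIV"
    and "sqrt (\<Sum>\<^sub>\<infinity>k. q k * (cmod (c k + d k))\<^sup>2) \<le>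
      sqrt (\<Sum>\<^sub>\<infinity>k. q k * (cmod (c k))\<^sup>2) + sqrt (\<Sum>\<^sub>\<infinity>k. q k * (cmod (d k))\<^sup>2)"
proof -
  let ?N = "\<lambda>c. sqrt (\<Sum>\<^sub>\<infinity>k. q k * (cmod (c k))\<^sup>2)"
  let ?L = "\<lambda>c F. L2_set (\<lambda>k. sqrt (q k) * cmod (c k)) F"
  have L: "?L c F = sqrt (\<Sum>k\<in>F. q k * (cmod (c k))\<^sup>2)" for c F
    using q by (simp add: L2_set_def power_mult_distrib)
  have le: "?L c F \<le> ?N c" if "(\<lambda>k. q k * (cmod (c k))\<^sup>2) summable_on UNIV" "finite F" for c F
    unfolding L using that q by (intro real_sqrt_le_mono finite_sum_le_infsum) auto
  have fin: "(\<Sum>k\<in>F. q k * (cmod (c k + d k))\<^sup>2) \<le> (?N c + ?N d)\<^sup>2" if "finite F" for F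
  proof -
    have "?L (\<lambda>k. c k + d k) F \<le> L2_set (\<lambda>k. sqrt (q k) * cmod (c k) + sqrt (q k) * cmod (d k)) F"
      using q by (intro L2_set_mono) (auto simp flip: distrib_left intro!: mult_left_mono norm_triangle_ineq)
    also have "\<dots> \<le> ?L c F + ?L d F"
      by (rule L2_set_triangle_ineq)
    also have "\<dots> \<le> ?N c + ?N d"
      by (intro add_mono le c d that)
    finally show ?thesis
      unfolding L by (rule sqrt_le_D)
  qed
  show sm: "(\<lambda>k. q k * (cmod (c k + d k))\<^sup>2) summable_on UNIV"
    by (rule nonneg_bdd_above_summable_on) (use q fin in \<open>auto intro!: bdd_aboveI2\<close>)
  have nn: "0 \<le> ?N c + ?N d"
    using q by (intro add_nonneg_nonneg real_sqrt_ge_zero infsum_nonneg) auto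
  have "(\<Sum>\<^sub>\<infinity>k. q k * (cmod (c k + d k))\<^sup>2) \<le> (?N c + ?N d)\<^sup>2"
    by (rule infsum_le_finite_sums[OF sm fin])
  then show "?N (\<lambda>k. c k + d k) \<le> ?N c + ?N d"
    using nn by (rule real_le_lsqrt[rotated])
qed

section \<open>Largest terms of a summable family\<close>

text \<open>
  The set of \<open>N\<close> largest terms exists although the family is infinite: only finitely many
  terms of a summable family exceed a given positive term, so the terms outside a finite set
  have a maximum, and the set can be enlarged one index at a time.
\<close>

lemma ex_dominating_subset:
  fixes a :: "'a \<Rightarrow> real"
  assumes "infinite (UNIV :: 'a set)" and nn: "\<And>k. 0 \<le> a k" and sm: "a summable_on UNIV"
  shows "\<exists>\<Lambda>. finite \<Lambda> \<and> card \<Lambda> = N \<and> (\<forall>k\<in>\<Lambda>. \<forall>j\<in>-\<Lambda>. a j \<le> a k)"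
proof (induction N)
  case 0
  show ?case by (intro exI[of _ "{}"]) simp
next
  case (Suc N)
  then obtain \<Lambda> where \<Lambda>: "finite \<Lambda>" "card \<Lambda> = N" "\<And>k j. k \<in> \<Lambda> \<Longrightarrow> j \<notin> \<Lambda> \<Longrightarrow> a j \<le> a k"
    by blast
  obtain j0 where j0: "j0 \<notin> \<Lambda>"
    using assms(1) \<Lambda>(1) ex_new_if_finite by blast
  obtain m where m: "m \<notin> \<Lambda>" "\<And>j. j \<notin> \<Lambda> \<Longrightarrow> a j \<le> a m"
  proof (cases "a j0 = 0 \<and> (\<forall>j. j \<notin> \<Lambda> \<longrightarrow> a j = 0)")
    case True
    then show ?thesis using that[of j0] j0 by auto
  next
    case False
    then obtain j1 where j1: "j1 \<notin> \<Lambda>" "a j1 > 0"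
      using nn j0 by (metis order_le_less)
    \<comment> \<open>The candidates that can beat \<open>j1\<close>; their number is at most \<open>infsum a UNIV / a j1\<close>.\<close>
    let ?S = "{j. j \<notin> \<Lambda> \<and> a j1 \<le> a j}"
    have "finite ?S"
    proof (rule ccontr)
      assume inf: "infinite ?S"
      obtain n :: nat where n: "infsum a UNIV < real n * a j1"
        using reals_Archimedean3[OF j1(2)] by blast
      obtain T where T: "T \<subseteq> ?S" "finite T" "card T = n"
        using infinite_arbitrarily_large[OF inf] by metis
      have "real n * a j1 \<le> sum a T"
        using sum_bounded_below[of T "a j1" a] T by auto
      also have "\<dots> \<le> infsum a UNIV"
        using T sm nn by (intro finite_sum_le_infsum) auto
      finally show False using n by simp
    qed
    moreover have "j1 \<in> ?S" using j1 by simp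
    ultimately have "Max (a ` ?S) \<in> a ` ?S" "\<And>j. j \<in> ?S \<Longrightarrow> a j \<le> Max (a ` ?S)"
      by (auto intro!: Max_in)
    then obtain m where "m \<in> ?S" "\<And>j. j \<in> ?S \<Longrightarrow> a j \<le> a m"
      by auto
    then show ?thesis using that[of m] by fastforce
  qed
  show ?case
    by (rule exI[of _ "insert m \<Lambda>"]) (use \<Lambda> m in auto)
qed

text \<open>
  A bijection between the two differences \<open>\<Lambda>' - \<Lambda>\<close> and \<open>\<Lambda> - \<Lambda>'\<close> exchanges each
  term for one that is at least as large.
\<close>

lemma sum_le_dominating_subset:
  fixes a :: "'a \<Rightarrow> real"
  assumes "finite \<Lambda>" "finite \<Lambda>'" "card \<Lambda>' = card \<Lambda>"
    and dom: "\<And>k j. k \<in> \<Lambda> \<Longrightarrow> j \<notin> \<Lambda> \<Longrightarrow> a j \<le> a k"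
  shows "sum a \<Lambda>' \<le> sum a \<Lambda>"
proof -
  have "card (\<Lambda>' - \<Lambda>) = card (\<Lambda> - \<Lambda>')"
    using assms(1-3) by (simp add: card_Diff_subset_Int Int_commute)
  then obtain f where f: "bij_betw f (\<Lambda>' - \<Lambda>) (\<Lambda> - \<Lambda>')"
    using assms(1,2) by (metis finite_Diff finite_same_card_bij)
  have "sum a (\<Lambda>' - \<Lambda>) \<le> (\<Sum>j\<in>\<Lambda>' - \<Lambda>. a (f j))"
    using bij_betwE[OF f] by (intro sum_mono dom) auto
  also have "\<dots> = sum a (\<Lambda> - \<Lambda>')"
    by (rule sum.reindex_bij_betw[OF f])
  finally show ?thesis
    using sum.Int_Diff[OF assms(2), of a \<Lambda>] sum.Int_Diff[OF assms(1), of a \<Lambda>']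
    by (simp add: Int_commute)
qed

section \<open>Orthonormality of the Fourier modes\<close>

lemma Basis_cart_real: "(Basis :: (real ^ 'n) set) = range (\<lambda>i. axis i 1)"
  by (auto simp: Basis_vec_def)

text \<open>
  Fubini's theorem for a product of functions of one coordinate each.  Lebesgue measure on the
  Euclidean space is by construction the image of the product measure indexed by the standard
  basis vectors, which have to be matched with the coordinate indices.
\<close>

lemma integral_lborel_prod_components:
  fixes f :: "'n::finite \<Rightarrow> real \<Rightarrow> complex"
  assumes "\<And>i. integrable lborel (f i)"
  shows "(\<integral>x. (\<Prod>i\<in>UNIV. f i (x $ i)) \<partial>(lborel :: (real ^ 'n) measure)) = (\<Prod>i\<in>UNIV. integral\<^sup>L lborel (f i))"
proof -
  interpret P: product_sigma_finite "\<lambda>_. lborel :: real measure" ..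
  let ?B = "Basis :: (real ^ 'n) set"
  define h where "h b = f (axis_index b)" for b :: "real ^ 'n"
  have inj: "inj (\<lambda>i::'n. axis i (1::real))"
    by (auto simp: inj_def axis_eq_axis)
  have reindex: "(\<Prod>b\<in>?B. g b) = (\<Prod>i\<in>UNIV. g (axis i 1))" for g :: "real ^ 'n \<Rightarrow> complex"
    unfolding Basis_cart_real by (subst prod.reindex[OF inj]) simp
  have h: "h (axis i 1) = f i" for i
    by (simp add: h_def axis_index_axis)
  have [measurable]: "f i \<in> borel_measurable borel" for i
    using assms borel_measurable_integrable[of lborel "f i"] by simp
  have comp: "(\<Sum>b\<in>?B. F b *\<^sub>R b) $ i = F (axis i 1)" for F i
    unfolding Basis_cart_real
    by (subst sum.reindex[OF inj]) (simp add: axis_def if_distrib cong: if_cong)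
  have "(\<integral>x. (\<Prod>i\<in>UNIV. f i (x $ i)) \<partial>(lborel :: (real ^ 'n) measure)) =
        (\<integral>F. (\<Prod>i\<in>UNIV. f i ((\<Sum>b\<in>?B. F b *\<^sub>R b) $ i)) \<partial>(\<Pi>\<^sub>M b\<in>?B. lborel))"
    by (subst lborel_eq, subst integral_distr) auto
  also have "\<dots> = (\<integral>F. (\<Prod>b\<in>?B. h b (F b)) \<partial>(\<Pi>\<^sub>M b\<in>?B. lborel))"
    by (simp only: comp reindex h)
  also have "\<dots> = (\<Prod>b\<in>?B. integral\<^sup>L lborel (h b))"
    by (rule P.product_integral_prod) (auto simp: h_def assms)
  finally show ?thesis by (simp add: reindex h)
qed

lemma integral_exp_int_period:
  fixes m :: int
  shows "integrable lborel (\<lambda>x. indicator {0<..<2*pi} x *\<^sub>R exp (\<i> * (of_int m * complex_of_real x)))"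
    "(\<integral>x. indicator {0<..<2*pi} x *\<^sub>R exp (\<i> * (of_int m * complex_of_real x)) \<partial>lborel) =
       (if m = 0 then 2 * pi else 0)"
proof -
  let ?g = "\<lambda>x. exp (\<i> * (of_int m * complex_of_real x))"
  have "set_integrable lborel {0..2*pi} ?g"
    by (rule borel_integrable_compact[unfolded set_integrable_def[symmetric]]) (auto intro!: continuous_intros)
  then have int: "set_integrable lborel {0<..<2*pi} ?g"
    by (rule set_integrable_subset) auto
  then show "integrable lborel (\<lambda>x. indicator {0<..<2*pi} x *\<^sub>R ?g x)"
    by (simp add: set_integrable_def)
  have "(LINT x:{0<..<2*pi}|lborel. ?g x) = integral {0<..<2*pi} ?g"
    by (rule set_borel_integral_eq_integral[OF int])
  also have "\<dots> = integral {0..2*pi} ?g"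
    using integral_open_interval[of 0 "2*pi" ?g] by simp
  also have "\<dots> = (if m = 0 then 2 * pi else 0)"
  proof (cases "m = 0")
    case False
    have "((\<lambda>x. ?g x / (\<i> * of_int m)) has_vector_derivative ?g x) (at x within {0..2*pi})" for x
      by (rule has_vector_derivative_real_field)
         (use False in \<open>auto intro!: derivative_eq_intros simp: field_simps\<close>)
    then have "(?g has_integral (?g (2*pi) / (\<i> * of_int m) - ?g 0 / (\<i> * of_int m))) {0..2*pi}"
      by (intro fundamental_theorem_of_calculus) auto
    moreover have "?g (2*pi) = 1"
      using exp_integer_2pi[of "of_int m"] by (simp add: mult_ac)
    ultimately show ?thesis using False by (simp add: integral_unique)
  qed (simp add: scaleR_conv_of_real)
  finally show "(\<integral>x. indicator {0<..<2*pi} x *\<^sub>R ?g x \<partial>lborel) = (if m = 0 then 2 * pi else 0)"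
    by (simp add: set_lebesgue_integral_def)
qed

lemma fourier_mode_prod:
  "fourier_mode k x = complex_of_real ((2 * pi) powr (- real CARD('n) / 2)) *
     (\<Prod>i\<in>UNIV. exp (\<i> * (of_int (k $ i) * complex_of_real (x $ i))))"
  for k :: "int ^ 'n"
  by (simp add: fourier_mode_def exp_sum sum_distrib_left)

lemma cnj_fourier_mode: "cnj (fourier_mode k x) = fourier_mode (- k) x"
  by (simp add: fourier_mode_def exp_cnj sum_negf)

text \<open>
  Both the integrand and the indicator of the cube are products over the coordinates, so the
  integral is a product of one-dimensional integrals over a period.  If \<open>k \<noteq> l\<close>, the factor of
  a coordinate where they differ vanishes.
\<close>

lemma integral_fourier_mode_mult_cnj:
  fixes k l :: "int ^ 'n"
  shows "(\<integral>x. fourier_mode k x * cnj (fourier_mode l x) \<partial>lebesgue_on Omega) = (if k = l then 1 else 0)"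
proof -
  let ?c = "complex_of_real ((2 * pi) powr (- real CARD('n)))"
  let ?f = "\<lambda>i x. indicator {0<..<2*pi} x *\<^sub>R exp (\<i> * (of_int ((k - l) $ i) * complex_of_real x))"
  have ind: "indicator (Omega :: (real ^ 'n) set) x = (\<Prod>i\<in>UNIV. indicator {0<..<2*pi} (x $ i) :: real)" for x
    by (auto simp: indicator_def Omega_def mem_box_cart prod_zero_iff)
  have cc: "complex_of_real ((2 * pi) powr (- real CARD('n) / 2)) * complex_of_real ((2 * pi) powr (- real CARD('n) / 2)) = ?c"
    by (simp flip: of_real_mult powr_add)
  have eq: "indicator (Omega :: (real ^ 'n) set) x *\<^sub>R (fourier_mode k x * cnj (fourier_mode l x)) = ?c * (\<Prod>i\<in>UNIV. ?f i (x $ i))" for x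
  proof -
    have "fourier_mode k x * cnj (fourier_mode l x) = ?c * (\<Prod>i\<in>UNIV. exp (\<i> * (of_int ((k - l) $ i) * complex_of_real (x $ i))))"
      unfolding cnj_fourier_mode cc[symmetric] unfolding fourier_mode_prod
      by (simp add: prod.distrib[symmetric] exp_add[symmetric] algebra_simps)
    then show ?thesis
      by (simp add: ind scaleR_conv_of_real prod.distrib)
  qed
  have op: "(Omega :: (real ^ 'n) set) \<in> sets lborel" by (simp add: Omega_def)
  have meas: "(\<lambda>x. ?c * (\<Prod>i\<in>UNIV. ?f i (x $ i))) \<in> borel_measurable (lborel :: (real ^ 'n) measure)"
    by measurable
  have "(\<integral>x. fourier_mode k x * cnj (fourier_mode l x) \<partial>lebesgue_on Omega) =
      (\<integral>x. indicator (Omega :: (real ^ 'n) set) x *\<^sub>R (fourier_mode k x * cnj (fourier_mode l x)) \<partial>lebesgue)"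
    by (rule integral_restrict_space) (use op in auto)
  also have "\<dots> = (\<integral>x. ?c * (\<Prod>i\<in>UNIV. ?f i (x $ i)) \<partial>lborel)"
    unfolding eq by (rule integral_completion[OF meas])
  also have "\<dots> = ?c * (\<Prod>i\<in>UNIV. integral\<^sup>L lborel (?f i))"
    by (subst integral_mult_right_zero, subst integral_lborel_prod_components)
       (simp_all only: integral_exp_int_period)
  also have "\<dots> = ?c * (\<Prod>i\<in>UNIV. if (k - l) $ i = 0 then 2 * pi else 0)"
    by (simp only: integral_exp_int_period of_real_prod) 
  also have "\<dots> = (if k = l then 1 else 0)"
    by (auto simp: vec_eq_iff powr_minus powr_realpow field_simps)
  finally show ?thesis .
qed

section \<open>Fourier coefficients and Bessel's inequality\<close>

lemma Omega_lmeasurable: "(Omega :: (real ^ 'n) set) \<in> lmeasurable"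
  by (simp add: Omega_def)

lemma finite_measure_Omega: "finite_measure (lebesgue_on (Omega :: (real ^ 'n) set))"
  using Omega_lmeasurable by (rule finite_measure_lebesgue_on)

lemma set_integral_Omega: "(LINT x:Omega|lebesgue. f x) = integral\<^sup>L (lebesgue_on Omega) f"
  for f :: "real ^ 'n \<Rightarrow> complex"
  unfolding set_lebesgue_integral_def
  by (rule integral_restrict_space[symmetric]) (use Omega_lmeasurable in auto)

lemma fourier_coeff_eq:
  "fourier_coeff v k = (\<integral>x. v x * cnj (fourier_mode k x) \<partial>lebesgue_on Omega)"
  by (simp add: fourier_coeff_def set_integral_Omega)

lemma square_integrable_Omega_iff:
  "square_integrable_Omega v \<longleftrightarrow>
     v \<in> borel_measurable (lebesgue_on Omega) \<and> integrable (lebesgue_on Omega) (\<lambda>x. (cmod (v x))\<^sup>2)"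
  for v :: "real ^ 'n \<Rightarrow> complex"
proof -
  have "Omega \<inter> space lebesgue \<in> sets (lebesgue :: (real ^ 'n) measure)"
    using Omega_lmeasurable by auto
  then show ?thesis
    unfolding square_integrable_Omega_def set_borel_measurable_def set_integrable_def
    by (simp add: borel_measurable_restrict_space_iff integrable_restrict_space)
qed

lemma cmod_fourier_mode: "cmod (fourier_mode k x) = (2 * pi) powr (- real CARD('n) / 2)"
  for k :: "int ^ 'n"
proof -
  have "cmod (exp (\<i> * complex_of_real (\<Sum>i\<in>UNIV. real_of_int (k $ i) * x $ i))) = 1"
    by (simp only: norm_exp_i_times)
  then show ?thesis unfolding fourier_mode_def norm_mult norm_of_real by simp
qed

lemma continuous_on_fourier_mode: "continuous_on S (fourier_mode k)"
  unfolding fourier_mode_def by (intro continuous_intros)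

lemma fourier_mode_measurable [measurable]: "fourier_mode k \<in> borel_measurable (lebesgue_on Omega)"
  for k :: "int ^ 'n"
  by (intro continuous_imp_measurable_on_sets_lebesgue continuous_on_fourier_mode)
     (use Omega_lmeasurable in auto)

text \<open>
  The cube has finite measure and \<open>cmod (v x) \<le> 1 + (cmod (v x))\<^sup>2\<close>, so square integrability
  implies integrability.
\<close>

lemma integrable_mult_cnj_fourier_mode:
  fixes k :: "int ^ 'n"
  assumes "square_integrable_Omega v"
  shows "integrable (lebesgue_on Omega) (\<lambda>x. v x * cnj (fourier_mode k x))"
proof -
  interpret finite_measure "lebesgue_on (Omega :: (real ^ 'n) set)"
    by (rule finite_measure_Omega)
  let ?c = "(2 * pi) powr (- real CARD('n) / 2)"
  have [measurable]: "v \<in> borel_measurable (lebesgue_on Omega)"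
    and int: "integrable (lebesgue_on Omega) (\<lambda>x. (cmod (v x))\<^sup>2)"
    using assms by (auto simp: square_integrable_Omega_iff)
  show ?thesis
  proof (rule Bochner_Integration.integrable_bound[where f = "\<lambda>x. (1 + (cmod (v x))\<^sup>2) * ?c"])
    show "integrable (lebesgue_on Omega) (\<lambda>x. (1 + (cmod (v x))\<^sup>2) * ?c)"
      using int by auto
    have "cmod (v x) \<le> 1 + (cmod (v x))\<^sup>2" for x
      using sum_squares_bound[of "cmod (v x)" 1] norm_ge_zero[of "v x"] by (simp del: norm_ge_zero)
    then show "AE x in lebesgue_on Omega. norm (v x * cnj (fourier_mode k x)) \<le> norm ((1 + (cmod (v x))\<^sup>2) * ?c)"
      by (auto simp: norm_mult cmod_fourier_mode intro!: mult_right_mono)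
    show "(\<lambda>x. v x * cnj (fourier_mode k x)) \<in> borel_measurable (lebesgue_on Omega)"
      unfolding cnj_fourier_mode by measurable
  qed
qed

lemma integrable_fourier_mode_mult_cnj:
  fixes k l :: "int ^ 'n"
  shows "integrable (lebesgue_on Omega) (\<lambda>x. fourier_mode k x * cnj (fourier_mode l x))"
proof (rule integrable_mult_cnj_fourier_mode)
  interpret finite_measure "lebesgue_on (Omega :: (real ^ 'n) set)"
    by (rule finite_measure_Omega)
  show "square_integrable_Omega (fourier_mode k)"
    by (simp add: square_integrable_Omega_iff cmod_fourier_mode)
qed

lemma has_bochner_integral_fourier_coeff:
  assumes "square_integrable_Omega v"
  shows "has_bochner_integral (lebesgue_on Omega) (\<lambda>x. v x * cnj (fourier_mode k x)) (fourier_coeff v k)"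
  by (simp add: has_bochner_integral_iff fourier_coeff_eq integrable_mult_cnj_fourier_mode assms)

lemma has_bochner_integral_fourier_mode_mult_cnj:
  "has_bochner_integral (lebesgue_on Omega) (\<lambda>x. fourier_mode k x * cnj (fourier_mode l x))
     (if k = l then 1 else 0)"
  unfolding has_bochner_integral_iff
  using integrable_fourier_mode_mult_cnj integral_fourier_mode_mult_cnj by blast

lemma fourier_coeff_diff:
  assumes "square_integrable_Omega v" "square_integrable_Omega w"
  shows "fourier_coeff (v - w) k = fourier_coeff v k - fourier_coeff w k"
  by (simp add: fourier_coeff_eq left_diff_distrib integrable_mult_cnj_fourier_mode assms)

lemma fourier_coeff_diff_proj:
  fixes k :: "int ^ 'n"
  assumes v: "square_integrable_Omega v" and "finite \<Lambda>"
  shows "fourier_coeff (v - fourier_proj \<Lambda> w) k =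
    fourier_coeff v k - (if k \<in> \<Lambda> then fourier_coeff w k else 0)"
proof -
  have "has_bochner_integral (lebesgue_on Omega)
      (\<lambda>x. v x * cnj (fourier_mode k x) -
         (\<Sum>l\<in>\<Lambda>. fourier_coeff w l * (fourier_mode l x * cnj (fourier_mode k x))))
      (fourier_coeff v k - (\<Sum>l\<in>\<Lambda>. fourier_coeff w l * (if l = k then 1 else 0)))"
    by (intro has_bochner_integral_diff has_bochner_integral_sum has_bochner_integral_mult_right
        has_bochner_integral_fourier_coeff[OF v] has_bochner_integral_fourier_mode_mult_cnj)
  then have "fourier_coeff (v - fourier_proj \<Lambda> w) k =
      fourier_coeff v k - (\<Sum>l\<in>\<Lambda>. fourier_coeff w l * (if l = k then 1 else 0))"
    by (simp add: fourier_coeff_eq[of "v - _"] fourier_proj_def left_diff_distrib sum_distrib_right mult.assoc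
        has_bochner_integral_iff)
  also have "(\<Sum>l\<in>\<Lambda>. fourier_coeff w l * (if l = k then 1 else 0)) = (if k \<in> \<Lambda> then fourier_coeff w k else 0)"
    using \<open>finite \<Lambda>\<close> by (simp add: if_distrib cong: if_cong)
  finally show ?thesis .
qed

text \<open>
  By orthonormality the square of the \<open>L\<^sup>2\<close> norm of the remainder \<open>g - fourier_proj F g\<close> is the
  difference of the two sides, hence this difference is nonnegative.
\<close>

lemma bessel_inequality:
  fixes F :: "(int ^ 'n) set"
  assumes g: "square_integrable_Omega g" and "finite F"
  shows "(\<Sum>k\<in>F. (cmod (fourier_coeff g k))\<^sup>2) \<le> (\<integral>x. (cmod (g x))\<^sup>2 \<partial>lebesgue_on Omega)"
proof -
  let ?M = "lebesgue_on (Omega :: (real ^ 'n) set)"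
  let ?c = "fourier_coeff g"
  let ?\<phi> = "fourier_mode :: int ^ 'n \<Rightarrow> _"
  define r where "r = g - fourier_proj F g"
  note gb = has_bochner_integral_fourier_coeff[OF g]
  note pb = has_bochner_integral_fourier_mode_mult_cnj
  have gb': "has_bochner_integral ?M (\<lambda>x. cnj (g x * cnj (?\<phi> k x))) (cnj (?c k))" for k
    using gb by (rule has_bochner_integral_cnj)
  have g2: "has_bochner_integral ?M (\<lambda>x. complex_of_real ((cmod (g x))\<^sup>2)) (complex_of_real (\<integral>x. (cmod (g x))\<^sup>2 \<partial>?M))"
    using g unfolding has_bochner_integral_iff by (auto simp: square_integrable_Omega_iff simp del: of_real_power)
  have "complex_of_real ((cmod (r x))\<^sup>2) =
      complex_of_real ((cmod (g x))\<^sup>2) - (\<Sum>k\<in>F. cnj (?c k) * (g x * cnj (?\<phi> k x)))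
        - (\<Sum>k\<in>F. ?c k * cnj (g x * cnj (?\<phi> k x)))
        + (\<Sum>k\<in>F. \<Sum>l\<in>F. (?c k * cnj (?c l)) * (?\<phi> k x * cnj (?\<phi> l x)))" for x
  proof -
    let ?s = "\<Sum>k\<in>F. ?c k * ?\<phi> k x"
    have "complex_of_real ((cmod (r x))\<^sup>2) = (g x - ?s) * cnj (g x - ?s)"
      by (simp only: complex_norm_square r_def fourier_proj_def fun_diff_def)
    also have "\<dots> = g x * cnj (g x) - g x * cnj ?s - ?s * cnj (g x) + ?s * cnj ?s"
      by (simp only: complex_cnj_diff) (simp only: algebra_simps)
    also have "g x * cnj ?s = (\<Sum>k\<in>F. cnj (?c k) * (g x * cnj (?\<phi> k x)))"
      by (simp add: sum_distrib_left mult_ac)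
    also have "?s * cnj (g x) = (\<Sum>k\<in>F. ?c k * cnj (g x * cnj (?\<phi> k x)))"
      by (simp add: sum_distrib_left mult_ac)
    also have "?s * cnj ?s = (\<Sum>k\<in>F. \<Sum>l\<in>F. (?c k * cnj (?c l)) * (?\<phi> k x * cnj (?\<phi> l x)))"
      by (simp add: sum_product mult_ac)
    finally show ?thesis by (simp only: complex_norm_square)
  qed
  then have "has_bochner_integral ?M (\<lambda>x. complex_of_real ((cmod (r x))\<^sup>2))
      (complex_of_real (\<integral>x. (cmod (g x))\<^sup>2 \<partial>?M) - (\<Sum>k\<in>F. cnj (?c k) * ?c k)
        - (\<Sum>k\<in>F. ?c k * cnj (?c k)) + (\<Sum>k\<in>F. \<Sum>l\<in>F. (?c k * cnj (?c l)) * (if k = l then 1 else 0)))"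
    by (simp only:) (intro has_bochner_integral_add has_bochner_integral_diff has_bochner_integral_sum
      has_bochner_integral_mult_right g2 gb gb' pb)
  moreover have "(\<Sum>k\<in>F. \<Sum>l\<in>F. (?c k * cnj (?c l)) * (if k = l then 1 else 0)) = (\<Sum>k\<in>F. ?c k * cnj (?c k))"
    using \<open>finite F\<close> by (simp add: if_distrib cong: if_cong)
  ultimately have "has_bochner_integral ?M (\<lambda>x. complex_of_real ((cmod (r x))\<^sup>2))
      (complex_of_real ((\<integral>x. (cmod (g x))\<^sup>2 \<partial>?M) - (\<Sum>k\<in>F. (cmod (?c k))\<^sup>2)))"
    by (simp add: complex_norm_square mult.commute[of "cnj _"] del: of_real_power)
  then have "complex_of_real (\<integral>x. (cmod (r x))\<^sup>2 \<partial>?M) =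
      complex_of_real ((\<integral>x. (cmod (g x))\<^sup>2 \<partial>?M) - (\<Sum>k\<in>F. (cmod (?c k))\<^sup>2))"
    unfolding has_bochner_integral_iff by (metis integral_complex_of_real)
  then have "(\<integral>x. (cmod (r x))\<^sup>2 \<partial>?M) = (\<integral>x. (cmod (g x))\<^sup>2 \<partial>?M) - (\<Sum>k\<in>F. (cmod (?c k))\<^sup>2)"
    by (simp only: of_real_eq_iff)
  moreover have "0 \<le> (\<integral>x. (cmod (r x))\<^sup>2 \<partial>?M)" by simp
  ultimately show ?thesis by simp
qed

section \<open>Summability for periodic Sobolev functions\<close>

lemma fourier_mode_has_derivative:
  "(fourier_mode k has_derivative
     (\<lambda>h. fourier_mode k x * (\<i> * complex_of_real (\<Sum>i\<in>UNIV. real_of_int (k $ i) * h $ i)))) (at x)"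
proof -
  let ?L = "\<lambda>x. complex_of_real (\<Sum>i\<in>UNIV. real_of_int (k $ i) * x $ i)"
  have "bounded_linear ?L"
    by (intro bounded_linear_compose[OF bounded_linear_of_real] bounded_linear_sum
        bounded_linear_compose[OF bounded_linear_mult_right] bounded_linear_vec_nth)
  then have "((\<lambda>x. \<i> * ?L x) has_derivative (\<lambda>h. \<i> * ?L h)) (at x)"
    by (intro has_derivative_mult_right bounded_linear_imp_has_derivative)
  from has_derivative_compose[OF this, of exp "(*) (exp (\<i> * ?L x))"]
  have "((\<lambda>x. exp (\<i> * ?L x)) has_derivative (\<lambda>h. exp (\<i> * ?L x) * (\<i> * ?L h))) (at x)"
    using DERIV_exp[of "\<i> * ?L x"] unfolding has_field_derivative_def by blast
  then show ?thesis
    unfolding fourier_mode_def mult.assoc by (rule has_derivative_mult_right)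
qed

lemma partial_deriv_fourier_mode:
  "partial_deriv j (\<lambda>x. c * fourier_mode k x) = (\<lambda>x. (c * (\<i> * of_int (k $ j))) * fourier_mode k x)"
proof
  fix x
  have "((\<lambda>x. c * fourier_mode k x) has_derivative
     (\<lambda>h. c * (fourier_mode k x * (\<i> * complex_of_real (\<Sum>i\<in>UNIV. real_of_int (k $ i) * h $ i))))) (at x)"
    by (intro has_derivative_mult_right fourier_mode_has_derivative)
  from frechet_derivative_at[OF this, symmetric]
  have "partial_deriv j (\<lambda>x. c * fourier_mode k x) x =
      c * (fourier_mode k x * (\<i> * complex_of_real (\<Sum>i\<in>UNIV. real_of_int (k $ i) * axis j 1 $ i)))"
    by (simp add: partial_deriv_def)
  moreover have "(\<Sum>i\<in>UNIV. real_of_int (k $ i) * axis j 1 $ i) = real_of_int (k $ j)"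
    by (simp add: axis_def if_distrib cong: if_cong)
  ultimately show "partial_deriv j (\<lambda>x. c * fourier_mode k x) x = (c * (\<i> * of_int (k $ j))) * fourier_mode k x"
    by simp
qed

text \<open>
  Every partial derivative of a multiple of a mode is again a multiple of the same mode, so the
  induction on the order of differentiability has to run over all multiples.
\<close>

lemma smooth_fourier_mode: "smooth (fourier_mode k)"
proof -
  have "C_diff m (\<lambda>x. c * fourier_mode k x)" for m c
  proof (induction m arbitrary: c)
    case 0
    show ?case by (auto intro!: continuous_intros continuous_on_fourier_mode)
  next
    case (Suc m)
    have "(\<lambda>x. c * fourier_mode k x) differentiable at x" for x
      unfolding differentiable_def using has_derivative_mult_right[OF fourier_mode_has_derivative] by blast
    then show ?case by (simp add: partial_deriv_fourier_mode Suc)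
  qed
  from this[of _ 1] show ?thesis by (simp add: smooth_def)
qed

lemma periodic_fourier_mode: "periodic (fourier_mode k)"
proof -
  have "fourier_mode k (x + axis j (2 * pi)) = fourier_mode k x" for x j
  proof -
    have "(\<Sum>i\<in>UNIV. real_of_int (k $ i) * (x + axis j (2 * pi)) $ i) =
        (\<Sum>i\<in>UNIV. real_of_int (k $ i) * x $ i) + 2 * pi * of_int (k $ j)"
      by (simp add: distrib_left sum.distrib) (simp add: axis_def if_distrib cong: if_cong)
    moreover have "exp (\<i> * complex_of_real (2 * pi * of_int (k $ j))) = 1"
      using exp_integer_2pi[of "of_int (k $ j)"] by (simp add: mult_ac)
    ultimately show ?thesis
      unfolding fourier_mode_def by (simp only: of_real_add distrib_left exp_add mult_1_right)
  qed
  then show ?thesis by (simp add: periodic_def)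
qed

text \<open>
  The mode with frequency \<open>- k\<close>, which is the conjugate of the mode with frequency \<open>k\<close>, is a
  test function in the definition of the weak derivative.
\<close>

lemma fourier_coeff_weak_partial_deriv:
  assumes "has_weak_partial_deriv j v g"
  shows "fourier_coeff g k = \<i> * of_int (k $ j) * fourier_coeff v k"
proof -
  have "partial_deriv j (fourier_mode (- k)) = (\<lambda>x. (\<i> * of_int ((- k) $ j)) * fourier_mode (- k) x)"
    using partial_deriv_fourier_mode[of j 1 "- k"] by simp
  moreover have "(LINT x:Omega|lebesgue. v x * partial_deriv j (fourier_mode (- k)) x) =
      - (LINT x:Omega|lebesgue. g x * fourier_mode (- k) x)"
    using assms smooth_fourier_mode periodic_fourier_mode unfolding has_weak_partial_deriv_def by blast
  ultimately have "(\<integral>x. (- \<i> * of_int (k $ j)) * (v x * fourier_mode (- k) x) \<partial>lebesgue_on Omega) =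
      - (\<integral>x. g x * fourier_mode (- k) x \<partial>lebesgue_on Omega)"
    by (simp add: set_integral_Omega mult_ac)
  then have "(- \<i> * of_int (k $ j)) * fourier_coeff v k = - fourier_coeff g k"
    by (simp only: integral_mult_right_zero fourier_coeff_eq cnj_fourier_mode)
  then show ?thesis by (simp add: minus_equation_iff)
qed

definition H1_weight :: "int ^ 'n \<Rightarrow> real" where
  "H1_weight k = 1 + (\<Sum>i\<in>UNIV. (real_of_int (k $ i))\<^sup>2)"

lemma H1_weight_nonneg: "0 \<le> H1_weight k"
  by (simp add: H1_weight_def add_nonneg_nonneg sum_nonneg)

text \<open>
  The weight splits the sum into the squared coefficients of \<open>v\<close> and those of its weak partial
  derivatives; each part is bounded by Bessel's inequality.  This is what makes the series in
  \<open>H1_norm\<close> meaningful: without summability \<open>infsum\<close> would be the default value 0.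
\<close>

lemma H1p_summable:
  assumes "v \<in> H1p"
  shows "(\<lambda>k. H1_weight k * (cmod (fourier_coeff v k))\<^sup>2) summable_on UNIV"
proof -
  have v: "square_integrable_Omega v"
    and "\<forall>j. \<exists>g. square_integrable_Omega g \<and> has_weak_partial_deriv j v g"
    using assms by (auto simp: H1p_def)
  then obtain g where g: "\<And>j. square_integrable_Omega (g j)" "\<And>j. has_weak_partial_deriv j v (g j)"
    by metis
  let ?I = "\<lambda>f. \<integral>x. (cmod (f x))\<^sup>2 \<partial>lebesgue_on Omega"
  have "(\<Sum>k\<in>F. H1_weight k * (cmod (fourier_coeff v k))\<^sup>2) \<le> ?I v + (\<Sum>j\<in>UNIV. ?I (g j))"
    if "finite F" for F
  proof -
    have "(\<Sum>k\<in>F. H1_weight k * (cmod (fourier_coeff v k))\<^sup>2) =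
        (\<Sum>k\<in>F. (cmod (fourier_coeff v k))\<^sup>2) + (\<Sum>k\<in>F. \<Sum>j\<in>UNIV. (cmod (fourier_coeff (g j) k))\<^sup>2)"
      by (simp add: H1_weight_def distrib_right sum.distrib sum_distrib_right norm_mult power_mult_distrib
          fourier_coeff_weak_partial_deriv[OF g(2)])
    also have "\<dots> = (\<Sum>k\<in>F. (cmod (fourier_coeff v k))\<^sup>2) + (\<Sum>j\<in>UNIV. \<Sum>k\<in>F. (cmod (fourier_coeff (g j) k))\<^sup>2)"
      by (subst sum.swap) simp
    also have "\<dots> \<le> ?I v + (\<Sum>j\<in>UNIV. ?I (g j))"
      using v g(1) that by (intro add_mono sum_mono bessel_inequality)
    finally show ?thesis .
  qed
  then show ?thesis
    by (intro nonneg_bdd_above_summable_on) (auto intro!: bdd_aboveI2 mult_nonneg_nonneg H1_weight_nonneg)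
qed

lemma H1_norm_eq: "H1_norm v = sqrt (\<Sum>\<^sub>\<infinity>k. H1_weight k * (cmod (fourier_coeff v k))\<^sup>2)"
  by (simp add: H1_norm_def H1_weight_def)

lemma H1p_square_integrable: "v \<in> H1p \<Longrightarrow> square_integrable_Omega v"
  by (simp add: H1p_def)

text \<open>
  The first estimate is the triangle inequality for \<open>v - w\<close> and the remainder of \<open>w\<close>.  The second
  compares the remainders of \<open>w\<close> and \<open>v\<close> for the same index set: they differ by the part of
  \<open>w - v\<close> with frequencies outside \<open>\<Lambda>\<close>, which is not larger than the whole of \<open>w - v\<close>.
\<close>

lemma H1_norm_diff_le:
  assumes v: "v \<in> H1p" and w: "w \<in> H1p" and fin: "finite \<Lambda>"
  shows "H1_norm (v - fourier_proj \<Lambda> w) \<le> H1_norm (v - w) + H1_norm (w - fourier_proj \<Lambda> w)"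
    and "H1_norm (w - fourier_proj \<Lambda> w) \<le> H1_norm (v - w) + H1_norm (v - fourier_proj \<Lambda> v)"
proof -
  let ?c = "fourier_coeff v" and ?d = "fourier_coeff w"
  let ?n = "\<lambda>c. \<lambda>k. H1_weight k * (cmod (c k))\<^sup>2"
  have vw: "fourier_coeff (v - w) = (\<lambda>k. ?c k - ?d k)"
    using v w by (simp add: fourier_coeff_diff H1p_square_integrable fun_eq_iff)
  have proj: "fourier_coeff (u - fourier_proj \<Lambda> u') = (\<lambda>k. fourier_coeff u k - (if k \<in> \<Lambda> then fourier_coeff u' k else 0))"
    if "u \<in> H1p" for u u'
    using that fin by (simp add: fourier_coeff_diff_proj H1p_square_integrable fun_eq_iff)
  have sd: "?n (\<lambda>k. ?c k - ?d k) summable_on UNIV"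
    using weighted_l2_triangle(1)[of H1_weight ?c "\<lambda>k. - ?d k"] H1p_summable[OF v] H1p_summable[OF w]
    by (simp add: H1_weight_nonneg)
  have off: "?n (\<lambda>k. if k \<in> \<Lambda> then 0 else u k) summable_on UNIV"
    if "?n u summable_on UNIV" for u
    by (rule summable_on_comparison_test[OF that]) (auto simp: H1_weight_nonneg)
  have e: "fourier_coeff (u - fourier_proj \<Lambda> u) = (\<lambda>k. if k \<in> \<Lambda> then 0 else fourier_coeff u k)"
    if "u \<in> H1p" for u
    by (auto simp: proj that)
  show "H1_norm (v - fourier_proj \<Lambda> w) \<le> H1_norm (v - w) + H1_norm (w - fourier_proj \<Lambda> w)"
  proof -
    have "fourier_coeff (v - fourier_proj \<Lambda> w) = (\<lambda>k. (?c k - ?d k) + (if k \<in> \<Lambda> then 0 else ?d k))"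
      by (auto simp: proj v)
    then show ?thesis
      unfolding H1_norm_eq vw e[OF w]
      using weighted_l2_triangle(2)[OF H1_weight_nonneg sd off[OF H1p_summable[OF w]]] by simp
  qed
  have tri: "H1_norm (w - fourier_proj \<Lambda> w) \<le>
      sqrt (\<Sum>\<^sub>\<infinity>k. ?n (\<lambda>k. if k \<in> \<Lambda> then 0 else ?d k - ?c k) k) + H1_norm (v - fourier_proj \<Lambda> v)"
  proof -
    \<comment> \<open>The remainder of \<open>w\<close> is the truncation of \<open>w - v\<close> plus the remainder of \<open>v\<close>.\<close>
    have ew: "fourier_coeff (w - fourier_proj \<Lambda> w) =
        (\<lambda>k. (if k \<in> \<Lambda> then 0 else ?d k - ?c k) + (if k \<in> \<Lambda> then 0 else ?c k))"
      by (auto simp: e w)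
    have dc: "?n (\<lambda>k. ?d k - ?c k) summable_on UNIV"
      using sd by (simp add: norm_minus_commute)
    show ?thesis
      unfolding H1_norm_eq ew e[OF v]
      by (rule weighted_l2_triangle(2)[OF H1_weight_nonneg off[OF dc] off[OF H1p_summable[OF v]]])
  qed
  have "sqrt (\<Sum>\<^sub>\<infinity>k. ?n (\<lambda>k. if k \<in> \<Lambda> then 0 else ?d k - ?c k) k) \<le> H1_norm (v - w)"
    unfolding H1_norm_eq vw using sd
    by (intro real_sqrt_le_mono infsum_mono off) (auto simp: H1_weight_nonneg norm_minus_commute)
  with tri show "H1_norm (w - fourier_proj \<Lambda> w) \<le> H1_norm (v - w) + H1_norm (v - fourier_proj \<Lambda> v)"
    by linarith
qed

section \<open>Best approximations and the smallest sufficient number of terms\<close>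

lemma infinite_UNIV_int_vec: "infinite (UNIV :: (int ^ 'n) set)"
proof
  assume "finite (UNIV :: (int ^ 'n) set)"
  moreover have "inj (\<lambda>z. (\<chi> i. z) :: int ^ 'n)"
    by (auto simp: inj_def vec_eq_iff)
  ultimately have "finite (UNIV :: int set)"
    by (metis finite_imageD finite_subset subset_UNIV)
  then show False by simp
qed

lemma H1_norm_remainder:
  assumes w: "w \<in> H1p" and fin: "finite \<Lambda>"
  defines "a \<equiv> \<lambda>k. H1_weight k * (cmod (fourier_coeff w k))\<^sup>2"
  shows "H1_norm (w - fourier_proj \<Lambda> w) = sqrt (infsum a UNIV - sum a \<Lambda>)"
proof -
  have sm: "a summable_on UNIV" unfolding a_def by (rule H1p_summable[OF w])
  have "(\<Sum>\<^sub>\<infinity>k. H1_weight k * (cmod (fourier_coeff (w - fourier_proj \<Lambda> w) k))\<^sup>2) = infsum a (UNIV - \<Lambda>)"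
    using w fin by (intro infsum_cong_neutral) (auto simp: a_def fourier_coeff_diff_proj H1p_square_integrable)
  also have "\<dots> = infsum a UNIV - sum a \<Lambda>"
    using infsum_Diff[OF sm, of \<Lambda>] fin by (simp add: summable_on_finite)
  finally show ?thesis by (simp add: H1_norm_eq)
qed

text \<open>
  The error is smallest when the retained part of the norm is largest, that is, when \<open>\<Lambda>\<close>
  consists of the frequencies with the \<open>N\<close> largest weighted coefficients.
\<close>

lemma ex_best_approx:
  assumes w: "w \<in> H1p"
  shows "\<exists>u. best_approx w N u"
proof -
  let ?a = "\<lambda>k. H1_weight k * (cmod (fourier_coeff w k))\<^sup>2"
  obtain \<Lambda> where \<Lambda>: "finite \<Lambda>" "card \<Lambda> = N" "\<And>k j. k \<in> \<Lambda> \<Longrightarrow> j \<notin> \<Lambda> \<Longrightarrow> ?a j \<le> ?a k"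
    using ex_dominating_subset[OF infinite_UNIV_int_vec, of ?a N] H1p_summable[OF w]
    by (auto simp: H1_weight_nonneg)
  have "is_arg_min (\<lambda>\<Lambda>. H1_norm (w - fourier_proj \<Lambda> w)) (\<lambda>\<Lambda>. finite \<Lambda> \<and> card \<Lambda> = N) \<Lambda>"
    unfolding is_arg_min_linorder
    using \<Lambda> sum_le_dominating_subset[of \<Lambda> _ ?a] by (auto simp: H1_norm_remainder[OF w])
  then show ?thesis unfolding best_approx_def by blast
qed

lemma ex_H1_norm_remainder_le:
  assumes w: "w \<in> H1p" and "\<delta> > 0"
  shows "\<exists>\<Lambda>. finite \<Lambda> \<and> H1_norm (w - fourier_proj \<Lambda> w) \<le> \<delta>"
proof -
  let ?a = "\<lambda>k. H1_weight k * (cmod (fourier_coeff w k))\<^sup>2"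
  obtain \<Lambda> where "finite \<Lambda>" "dist (sum ?a \<Lambda>) (infsum ?a UNIV) \<le> \<delta>\<^sup>2"
    using infsum_finite_approximation[OF H1p_summable[OF w], of "\<delta>\<^sup>2"] \<open>\<delta> > 0\<close> by auto
  then have "H1_norm (w - fourier_proj \<Lambda> w) \<le> \<delta>"
    unfolding H1_norm_remainder[OF w \<open>finite \<Lambda>\<close>]
    using \<open>\<delta> > 0\<close> by (intro real_le_lsqrt) (auto simp: dist_real_def)
  with \<open>finite \<Lambda>\<close> show ?thesis by blast
qed

lemma best_approx_le:
  assumes "best_approx w N u" "finite \<Lambda>" "card \<Lambda> = N"
  shows "H1_norm (w - u) \<le> H1_norm (w - fourier_proj \<Lambda> w)"
  using assms unfolding best_approx_def is_arg_min_linorder by blast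

lemma is_smallest_N_bounds:
  assumes "is_smallest_N w \<delta> N"
  shows "best_approx w N u \<Longrightarrow> H1_norm (w - u) \<le> \<delta>"
    and "n < N \<Longrightarrow> best_approx w n u \<Longrightarrow> \<delta> < H1_norm (w - u)"
proof -
  have ex: "\<exists>u'. best_approx w N u' \<and> H1_norm (w - u') \<le> \<delta>"
    and min: "\<And>n. n < N \<Longrightarrow> \<not> (\<exists>u. best_approx w n u \<and> H1_norm (w - u) \<le> \<delta>)"
    using assms unfolding is_smallest_N_def is_arg_min_def by blast+
  show "H1_norm (w - u) \<le> \<delta>" if u: "best_approx w N u"
  proof -
    obtain u' \<Lambda> where "H1_norm (w - u') \<le> \<delta>" "u' = fourier_proj \<Lambda> w" "finite \<Lambda>" "card \<Lambda> = N"
      using ex unfolding best_approx_def is_arg_min_def by blast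
    then show ?thesis using best_approx_le[OF u, of \<Lambda>] by simp
  qed
  show "\<delta> < H1_norm (w - u)" if "n < N" "best_approx w n u"
    using min that by force
qed

text \<open>
  The cardinality of a finite set that leaves a remainder of norm at most \<open>\<delta>\<close> suffices, since the
  best approximation with as many terms is at least as good.
\<close>

lemma ex_is_smallest_N:
  assumes w: "w \<in> H1p" and "\<delta> > 0"
  shows "\<exists>N. is_smallest_N w \<delta> N"
proof -
  obtain \<Lambda> where \<Lambda>: "finite \<Lambda>" "H1_norm (w - fourier_proj \<Lambda> w) \<le> \<delta>"
    using ex_H1_norm_remainder_le[OF assms] by blast
  obtain u where "best_approx w (card \<Lambda>) u"
    using ex_best_approx[OF w] by blast
  with best_approx_le[OF this \<Lambda>(1) refl] \<Lambda>(2)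
  have "\<exists>n u. best_approx w n u \<and> H1_norm (w - u) \<le> \<delta>"
    by force
  then show ?thesis
    unfolding is_smallest_N_def is_arg_min_def
    using exists_least_iff[of "\<lambda>n. \<exists>u. best_approx w n u \<and> H1_norm (w - u) \<le> \<delta>"] by blast
qed

section \<open>Decay of the best errors bounds the number of terms\<close>

lemma unit_ball_measure_pos: "0 < unit_ball_measure TYPE('n::finite)"
  unfolding unit_ball_measure_def using content_ball_pos[of 1 "0 :: real ^ 'n"] by simp

text \<open>
  With \<open>n < N\<close> terms, no index set approximates \<open>w\<close> within \<open>2 * \<epsilon>\<close>, because the best one does
  not.  The perturbation from \<open>w\<close> to \<open>v\<close> changes the error for a fixed index set by at most \<open>\<epsilon>\<close>,
  so none approximates \<open>v\<close> with an error below \<open>\<epsilon>\<close>.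
\<close>

lemma le_best_error_below_smallest_N:
  fixes v w :: "real ^ 'n \<Rightarrow> complex"
  assumes "v \<in> H1p" "w \<in> H1p" "H1_norm (v - w) \<le> \<epsilon>"
    and "is_smallest_N w (2 * \<epsilon>) N" "n < N"
  shows "\<epsilon> \<le> best_error n v"
  unfolding best_error_def
proof (rule cINF_greatest)
  show "{\<Lambda> :: (int ^ 'n) set. finite \<Lambda> \<and> card \<Lambda> = n} \<noteq> {}"
    using infinite_arbitrarily_large[OF infinite_UNIV_int_vec, of n] by auto
  fix \<Lambda> :: "(int ^ 'n) set" assume "\<Lambda> \<in> {\<Lambda>. finite \<Lambda> \<and> card \<Lambda> = n}"
  then have \<Lambda>: "finite \<Lambda>" "card \<Lambda> = n" by auto
  obtain u where u: "best_approx w n u" using ex_best_approx[OF assms(2)] by blast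
  have "2 * \<epsilon> < H1_norm (w - u)"
    by (rule is_smallest_N_bounds(2)) (use assms u in auto)
  also have "\<dots> \<le> H1_norm (w - fourier_proj \<Lambda> w)"
    by (rule best_approx_le[OF u \<Lambda>])
  also have "\<dots> \<le> H1_norm (v - w) + H1_norm (v - fourier_proj \<Lambda> v)"
    by (rule H1_norm_diff_le(2)) (use assms \<Lambda> in auto)
  finally show "\<epsilon> \<le> H1_norm (v - fourier_proj \<Lambda> v)" using assms(3) by simp
qed

text \<open>
  By the definition of the class norm \<open>A\<close> of \<open>v\<close>, the lower bound \<open>\<epsilon>\<close> for the error gives
  \<open>\<epsilon> * exp (\<eta> * (n / \<omega>) powr (t / d)) \<le> A\<close>, where \<open>\<omega>\<close> is the measure of the unit ball.
  Solving for \<open>n\<close> gives the claim.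
\<close>

lemma index_le_of_le_best_error:
  fixes v :: "real ^ 'n \<Rightarrow> complex"
  assumes "\<eta> > 0" "0 < t" "v \<in> exp_class \<eta> t" "0 < \<epsilon>" "\<epsilon> \<le> best_error n v"
  shows "real n \<le> unit_ball_measure TYPE('n) / \<eta> powr (real CARD('n) / t) *
         (ln (exp_class_norm \<eta> t v / \<epsilon>)) powr (real CARD('n) / t)"
proof -
  let ?\<omega> = "unit_ball_measure TYPE('n)" and ?d = "real CARD('n)"
  let ?A = "exp_class_norm \<eta> t v"
  let ?x = "\<eta> * ?\<omega> powr (- t / ?d) * real n powr (t / ?d)"
  have \<omega>: "0 < ?\<omega>" by (rule unit_ball_measure_pos)
  have d: "0 < ?d" by simp
  have "\<epsilon> * exp ?x \<le> weighted_error \<eta> t v n"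
    unfolding weighted_error_def using assms(5) by (intro mult_right_mono) auto
  also have "\<dots> \<le> ?A"
    unfolding exp_class_norm_def using assms(3) by (intro cSUP_upper) (auto simp: exp_class_def)
  finally have le: "exp ?x \<le> ?A / \<epsilon>"
    using \<open>0 < \<epsilon>\<close> by (simp add: field_simps)
  then have "?x \<le> ln (?A / \<epsilon>)"
    by (metis exp_gt_zero ln_exp ln_le_cancel_iff order_less_le_trans)
  then have "?x powr (?d / t) \<le> ln (?A / \<epsilon>) powr (?d / t)"
    using assms d by (intro powr_mono2) auto
  moreover have "?x powr (?d / t) = \<eta> powr (?d / t) / ?\<omega> * real n"
  proof -
    have "(?\<omega> powr (- t / ?d)) powr (?d / t) = 1 / ?\<omega>" "(real n powr (t / ?d)) powr (?d / t) = real n"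
      unfolding powr_powr using assms(2) \<omega> by (simp_all add: powr_minus_divide)
    then show ?thesis
      using assms(1) by (simp add: powr_mult)
  qed
  ultimately have "\<eta> powr (?d / t) / ?\<omega> * real n \<le> ln (?A / \<epsilon>) powr (?d / t)"
    by (simp only:)
  then show ?thesis
    using assms(1) \<omega> by (simp add: field_simps)
qed

theorem theorem6p1:
  fixes v w :: "real ^ 'n \<Rightarrow> complex" and \<eta> t \<epsilon> :: real
  assumes "\<eta> > 0"
    and "0 < t" and "t \<le> real CARD('n)"
    and "v \<in> exp_class \<eta> t"
    and "0 < \<epsilon>" and "\<epsilon> \<le> exp_class_norm \<eta> t v"
    and "w \<in> H1p"
    and "H1_norm (v - w) \<le> \<epsilon>"
  shows "(\<exists>N. is_smallest_N w (2 * \<epsilon>) N) \<and>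
    (\<forall>N w\<^sub>N. is_smallest_N w (2 * \<epsilon>) N \<and> best_approx w N w\<^sub>N \<longrightarrow>
       H1_norm (w - w\<^sub>N) \<le> 2 * \<epsilon> \<and>
       H1_norm (v - w\<^sub>N) \<le> 3 * \<epsilon> \<and>
       real N \<le> unit_ball_measure TYPE('n) / \<eta> powr (real CARD('n) / t) *
         (ln (exp_class_norm \<eta> t v / \<epsilon>)) powr (real CARD('n) / t) + 1)"
proof (intro conjI allI impI; (elim conjE)?)
  have v: "v \<in> H1p" using assms(4) by (simp add: exp_class_def)
  show "\<exists>N. is_smallest_N w (2 * \<epsilon>) N"
    by (rule ex_is_smallest_N) (use assms in auto)
  fix N w\<^sub>N assume N: "is_smallest_N w (2 * \<epsilon>) N" and wN: "best_approx w N w\<^sub>N"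
  show le: "H1_norm (w - w\<^sub>N) \<le> 2 * \<epsilon>"
    by (rule is_smallest_N_bounds(1)[OF N wN])
  obtain \<Lambda> where \<Lambda>: "finite \<Lambda>" "w\<^sub>N = fourier_proj \<Lambda> w"
    using wN unfolding best_approx_def is_arg_min_def by blast
  show "H1_norm (v - w\<^sub>N) \<le> 3 * \<epsilon>"
    using H1_norm_diff_le(1)[OF v assms(7) \<Lambda>(1)] le assms(8) \<Lambda>(2) by simp
  let ?b = "unit_ball_measure TYPE('n) / \<eta> powr (real CARD('n) / t) *
         (ln (exp_class_norm \<eta> t v / \<epsilon>)) powr (real CARD('n) / t)"
  show "real N \<le> ?b + 1"
  proof (cases N)
    case 0
    then show ?thesis using unit_ball_measure_pos[where 'n='n] by (simp add: add_nonneg_nonneg)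
  next
    \<comment> \<open>Minimality of \<open>N\<close> speaks of \<open>N - 1\<close> terms, hence the summand 1 in the bound.\<close>
    case (Suc n)
    have "\<epsilon> \<le> best_error n v"
      by (rule le_best_error_below_smallest_N[OF v assms(7,8) N]) (simp add: Suc)
    then show ?thesis
      using index_le_of_le_best_error[of \<eta> t v \<epsilon> n] assms Suc by simp
  qed
qed

end
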